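(* For all $w_1, w_2\in\mathbb{N}$ and all $x$, the following identity holds (as an identity of formal power series in $t$): $$\left(\frac{1}{w_1}\int_{\mathbb{Z}_p}e^{w_1(x_1+w_2x)t}\,dx_1 \right)\left(\frac{w_1\int_{\mathbb{Z}_p}e^{w_2x_2t}\,dx_2}{\int_{\mathbb{Z}_p}e^{w_1w_2x_3t}\,dx_3}\right)=\left(\frac{1}{w_2}\int_{\mathbb{Z}_p}e^{w_2(x_2+w_1x)t}\,dx_2\right)\left(\frac{w_2 \int_{\mathbb{Z}_p}e^{w_1x_1t}\,dx_1}{\int_{\mathbb{Z}_p}e^{w_1w_2x_3t}\,dx_3}\right).$$
   Context: Let $p$ be a fixed prime, $\mathbb{Z}_p$ the ring of $p$-adic integers, $\mathbb{C}_p$ the completion of an algebraic closure of $\mathbb{Q}_p$, and $\mathbb{N}$ the positive integers. For a uniformly differentiable function $f:\mathbb{Z}_p\to\mathbb{C}_p$, the $p$-adic invariant (Volkenborn) integral is $$\int_{\mathbb{Z}_p} f(y)\,dy=\lim_{N\to\infty}\frac{1}{p^N}\sum_{y=0}^{p^N-1}f(y).$$ Here $t$ is a formal variable and $x\in\mathbb{C}_p$ is a parameter; integrals of exponentials are taken coefficientwise in $t$, i.e. for $a,b\in\mathbb{C}_p$, $\int_{\mathbb{Z}_p}e^{(ay+b)t}\,dy=\sum_{n\ge 0}\left(\int_{\mathbb{Z}_p}(ay+b)^n\,dy\right)\frac{t^n}{n!}$. *)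

theory Defs
  imports "HOL-Analysis.Analysis" "HOL-Computational_Algebra.Computational_Algebra"
begin

text \<open>
  The base type is a field with a complete metric. The library's constant \<^const>\<open>norm\<close> is
  reserved for real normed spaces, so the absolute value is taken to be the distance to \<open>0\<close>; that
  the metric is the one induced by this absolute value is required in \<open>is_Cp\<close> below.
\<close>

definition absv :: "'a::{field_char_0, complete_space} \<Rightarrow> real" where
  "absv x = dist x 0"

definition Zp :: "'a::{field_char_0, complete_space} set" where
  "Zp = closure \<int>"

definition Qp :: "'a::{field_char_0, complete_space} set" where
  "Qp = closure \<rat>"

definition Qp_algebraic :: "'a::{field_char_0, complete_space} set" where
  "Qp_algebraic = {x. \<exists>q. q \<noteq> 0 \<and> (\<forall>i. coeff q i \<in> Qp) \<and> poly q x = 0}"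

text \<open>
  The field \<open>'a\<close> is the completion of an algebraic closure of the \<open>p\<close>-adic numbers.
  The function \<^const>\<open>absv\<close> is a non-archimedean absolute value that restricts to the \<open>p\<close>-adic one on the
  integers, so that \<^const>\<open>Zp\<close> and \<^const>\<open>Qp\<close> are the completions of the integers and the
  rationals (\<open>'a\<close> being complete). The elements algebraic over \<^const>\<open>Qp\<close> are algebraically
  closed, hence form an algebraic closure of \<^const>\<open>Qp\<close>, and they are dense. This determines
  \<open>'a\<close> up to isometric isomorphism.
\<close>

definition is_Cp :: "nat \<Rightarrow> 'a::{field_char_0, complete_space} itself \<Rightarrow> bool" where
  "is_Cp p (_ :: 'a itself) \<longleftrightarrow>
     (\<forall>x y :: 'a. dist x y = absv (x - y)) \<and>
     (\<forall>x y :: 'a. absv (x * y) = absv x * absv y) \<and>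
     (\<forall>x y :: 'a. absv (x + y) \<le> max (absv x) (absv y)) \<and>
     (\<forall>m :: int. m \<noteq> 0 \<longrightarrow> absv (of_int m :: 'a) = 1 / real p ^ multiplicity (int p) m) \<and>
     (\<forall>q :: 'a poly. degree q > 0 \<and> (\<forall>i. coeff q i \<in> Qp_algebraic) \<longrightarrow>
        (\<exists>x \<in> Qp_algebraic. poly q x = 0)) \<and>
     closure (Qp_algebraic :: 'a set) = UNIV"

text \<open>Only the values of \<open>f\<close> on \<^const>\<open>Zp\<close> matter in the following definitions.\<close>

definition uniformly_differentiable ::
    "('a::{field_char_0, complete_space} \<Rightarrow> 'a) \<Rightarrow> bool" where
  "uniformly_differentiable f \<longleftrightarrow>
     (\<forall>a \<in> Zp. \<exists>l. ((\<lambda>(x, y). (f x - f y) / (x - y)) \<longlongrightarrow> l)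
        (at (a, a) within {(x, y). x \<in> Zp \<and> y \<in> Zp \<and> x \<noteq> y}))"

definition has_volkenborn_integral ::
    "nat \<Rightarrow> ('a::{field_char_0, complete_space} \<Rightarrow> 'a) \<Rightarrow> 'a \<Rightarrow> bool" where
  "has_volkenborn_integral p f I \<longleftrightarrow> uniformly_differentiable f \<and>
     (\<lambda>N. 1 / of_nat (p ^ N) * (\<Sum>y<p ^ N. f (of_nat y))) \<longlonglongrightarrow> I"

definition volkenborn_integral ::
    "nat \<Rightarrow> ('a::{field_char_0, complete_space} \<Rightarrow> 'a) \<Rightarrow> 'a" where
  "volkenborn_integral p f = (THE I. has_volkenborn_integral p f I)"

text \<open>The coefficientwise integral of \<open>exp ((a * y + b) * t)\<close> over \<open>y\<close>, as a series in \<open>t\<close>.\<close>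

definition volkenborn_exp ::
    "nat \<Rightarrow> 'a::{field_char_0, complete_space} \<Rightarrow> 'a \<Rightarrow> 'a fps" where
  "volkenborn_exp p a b = Abs_fps (\<lambda>n. volkenborn_integral p (\<lambda>y. (a * y + b) ^ n) / fact n)"

end

theory Submission
  imports Defs
begin

text \<open>
  The average of \<open>y ^ k\<close> over \<open>y < n\<close> is a polynomial in \<open>n\<close>, and \<open>p ^ N\<close> tends to
  \<open>0\<close> \<open>p\<close>-adically, so polynomials have Volkenborn integrals. By linearity and the binomial
  theorem, the integral of \<open>exp ((a * y + b) * t)\<close> is \<open>exp (b * t)\<close> times that of
  \<open>exp (a * y * t)\<close>. Both sides of the identity therefore reduce to the same product, the
  denominator being an invertible power series since its constant term is \<open>1\<close>.
\<close>

text \<open>Telescoping \<open>(y + 1) ^ Suc k - y ^ Suc k\<close> and expanding it binomially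
  expresses the \<open>k\<close>-th power sum through the lower ones. The factor
  \<open>of_nat n\<close> is split off so that the mean over \<open>n\<close> terms is itself
  polynomial in \<open>n\<close>.\<close>

lemma power_sum_eq_poly:
  "\<exists>Q :: 'a::field_char_0 poly. \<forall>n. (\<Sum>y<n. of_nat y ^ k) = of_nat n * poly Q (of_nat n)"
proof (induction k rule: less_induct)
  case (less k)
  then have "\<forall>j\<in>{..<k}. \<exists>Q :: 'a poly. \<forall>n. (\<Sum>y<n. of_nat y ^ j) = of_nat n * poly Q (of_nat n)"
    by simp
  then obtain Q :: "nat \<Rightarrow> 'a poly"
    where Q: "\<And>j n. j < k \<Longrightarrow> (\<Sum>y<n. of_nat y ^ j) = of_nat n * poly (Q j) (of_nat n)"
    by (metis bchoice lessThan_iff)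
  \<comment> \<open>The telescoped recursion solved for the \<open>k\<close>-th power sum; dividing
    by \<open>Suc k\<close> is legitimate in characteristic 0.\<close>
  define R where
    "R = smult (1 / of_nat (Suc k)) (monom 1 k - (\<Sum>j<k. smult (of_nat (Suc k choose j)) (Q j)))"
  have "(\<Sum>y<n. of_nat y ^ k) = of_nat n * poly R (of_nat n)" for n
  proof -
    have step: "of_nat (Suc y) ^ Suc k - of_nat y ^ Suc k =
        (\<Sum>j\<le>k. of_nat (Suc k choose j) * of_nat y ^ j :: 'a)" for y
    proof -
      have "(of_nat y + 1) ^ Suc k = (\<Sum>j\<le>Suc k. of_nat (Suc k choose j) * of_nat y ^ j :: 'a)"
        by (subst binomial_ring) simp
      then show ?thesis
        by (simp add: add.commute)
    qed
    have "of_nat n ^ Suc k = (\<Sum>y<n. of_nat (Suc y) ^ Suc k - of_nat y ^ Suc k :: 'a)"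
      by (subst sum_lessThan_telescope) simp
    also have "\<dots> = (\<Sum>y<n. \<Sum>j\<le>k. of_nat (Suc k choose j) * of_nat y ^ j)"
      by (simp only: step)
    also have "\<dots> = (\<Sum>j\<le>k. of_nat (Suc k choose j) * (\<Sum>y<n. of_nat y ^ j))"
      by (subst sum.swap) (simp add: sum_distrib_left)
    also have "\<dots> = of_nat (Suc k) * (\<Sum>y<n. of_nat y ^ k) +
        (\<Sum>j<k. of_nat (Suc k choose j) * (of_nat n * poly (Q j) (of_nat n)))"
      by (simp add: lessThan_Suc_atMost [symmetric] Q)
    finally have "of_nat (Suc k) * (\<Sum>y<n. of_nat y ^ k) = of_nat n *
        (of_nat n ^ k - (\<Sum>j<k. of_nat (Suc k choose j) * poly (Q j) (of_nat n) :: 'a))"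
      by (simp add: right_diff_distrib sum_distrib_left mult.left_commute)
    then show ?thesis
      by (simp add: R_def poly_monom poly_sum eq_divide_eq mult.commute del: of_nat_Suc)
  qed
  then show ?case
    by blast
qed

context
  fixes p :: nat
  assumes Cp: "is_Cp p TYPE('a::{field_char_0, complete_space})"
begin

lemma dist_eq_absv: "dist x y = absv (x - y :: 'a)"
  by (rule Cp [unfolded is_Cp_def, THEN conjunct1, rule_format])

lemma absv_mult: "absv (x * y :: 'a) = absv x * absv y"
  by (rule Cp [unfolded is_Cp_def, THEN conjunct2, THEN conjunct1, rule_format])

lemma absv_add_le_max: "absv (x + y :: 'a) \<le> max (absv x) (absv y)"
  by (rule Cp [unfolded is_Cp_def, THEN conjunct2, THEN conjunct2, THEN conjunct1, rule_format])

lemma absv_of_int: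
  "m \<noteq> 0 \<Longrightarrow> absv (of_int m :: 'a) = 1 / real p ^ multiplicity (int p) m"
  by (rule Cp [unfolded is_Cp_def, THEN conjunct2, THEN conjunct2, THEN conjunct2, THEN conjunct1,
        rule_format])

lemma absv_nonneg: "0 \<le> absv (x :: 'a)"
  by (simp add: absv_def)

lemma absv_add_le: "absv (x + y :: 'a) \<le> absv x + absv y"
  using absv_add_le_max [of x y] absv_nonneg [of x] absv_nonneg [of y] by linarith

text \<open>The sort of \<open>'a\<close> does not tie the metric to the arithmetic; only
  \<open>is_Cp\<close> does. The limit laws for sums and products are therefore derived from the
  absolute value.\<close>

lemma tendsto_add_absv:
  fixes f g :: "'b \<Rightarrow> 'a"
  assumes "(f \<longlongrightarrow> a) F" "(g \<longlongrightarrow> b) F"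
  shows "((\<lambda>x. f x + g x) \<longlongrightarrow> a + b) F"
proof -
  have "((\<lambda>x. dist (f x) a + dist (g x) b) \<longlongrightarrow> 0 + 0) F"
    by (intro tendsto_add) (use assms in \<open>simp_all flip: tendsto_dist_iff\<close>)
  moreover have "dist (f x + g x) (a + b) \<le> dist (f x) a + dist (g x) b" for x
    using absv_add_le [of "f x - a" "g x - b"] by (simp add: dist_eq_absv algebra_simps)
  ultimately show ?thesis
    by (subst tendsto_dist_iff) (rule Lim_null_comparison, auto)
qed

lemma tendsto_mult_absv:
  fixes f g :: "'b \<Rightarrow> 'a"
  assumes "(f \<longlongrightarrow> a) F" "(g \<longlongrightarrow> b) F"
  shows "((\<lambda>x. f x * g x) \<longlongrightarrow> a * b) F"
proof -
  have "((\<lambda>x. dist (f x) a * dist (g x) b + (absv a * dist (g x) b + absv b * dist (f x) a))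
      \<longlongrightarrow> 0 * 0 + (absv a * 0 + absv b * 0)) F"
    by (intro tendsto_add tendsto_mult tendsto_const)
      (use assms in \<open>simp_all flip: tendsto_dist_iff\<close>)
  moreover have "dist (f x * g x) (a * b) \<le>
      dist (f x) a * dist (g x) b + (absv a * dist (g x) b + absv b * dist (f x) a)" for x
  proof -
    \<comment> \<open>Expanding around the limits makes every summand contain a factor that tends to
      0.\<close>
    have "f x * g x - a * b = (f x - a) * (g x - b) + (a * (g x - b) + b * (f x - a))"
      by (simp add: algebra_simps)
    then show ?thesis
      using absv_add_le [of "(f x - a) * (g x - b)" "a * (g x - b) + b * (f x - a)"]
        absv_add_le [of "a * (g x - b)" "b * (f x - a)"]
      by (simp add: dist_eq_absv absv_mult)
  qed
  ultimately show ?thesis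
    by (subst tendsto_dist_iff) (rule Lim_null_comparison, auto)
qed

lemma tendsto_sum_absv:
  fixes f :: "'b \<Rightarrow> 'c \<Rightarrow> 'a"
  assumes "\<And>i. i \<in> I \<Longrightarrow> (f i \<longlongrightarrow> a i) F"
  shows "((\<lambda>x. \<Sum>i\<in>I. f i x) \<longlongrightarrow> (\<Sum>i\<in>I. a i)) F"
  using assms by (induction I rule: infinite_finite_induct) (auto intro: tendsto_add_absv)

lemma tendsto_poly_absv:
  fixes f :: "'b \<Rightarrow> 'a"
  assumes "(f \<longlongrightarrow> a) F"
  shows "((\<lambda>x. poly P (f x)) \<longlongrightarrow> poly P a) F"
  by (induction P) (auto intro!: tendsto_add_absv tendsto_mult_absv assms)

text \<open>Induction on the coefficients: the difference quotient of \<open>c + X * P\<close> at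
  \<open>(x, y)\<close> is \<open>x\<close> times that of \<open>P\<close>, plus
  \<open>P(y)\<close>, so its limit is \<open>a * l + P(a)\<close>.\<close>

lemma uniformly_differentiable_poly: "uniformly_differentiable (poly P :: 'a \<Rightarrow> 'a)"
  unfolding uniformly_differentiable_def
proof
  fix a :: 'a
  let ?F = "at (a, a) within {(x, y). x \<in> Zp \<and> y \<in> Zp \<and> x \<noteq> y}"
  show "\<exists>l. ((\<lambda>(x, y). (poly P x - poly P y) / (x - y)) \<longlongrightarrow> l) ?F"
  proof (induction P)
    case 0
    show ?case
      by (auto simp: case_prod_unfold)
  next
    case (pCons c P)
    then obtain l where l: "((\<lambda>(x, y). (poly P x - poly P y) / (x - y)) \<longlongrightarrow> l) ?F"
      by blast
    have fst: "((\<lambda>z. fst z) \<longlongrightarrow> a) ?F" and snd: "((\<lambda>z. snd z) \<longlongrightarrow> a) ?F"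
      using tendsto_fst [OF tendsto_ident_at] tendsto_snd [OF tendsto_ident_at] by fastforce+
    have "((\<lambda>z. fst z * (\<lambda>(x, y). (poly P x - poly P y) / (x - y)) z + poly P (snd z))
        \<longlongrightarrow> a * l + poly P a) ?F"
      by (intro tendsto_add_absv tendsto_mult_absv tendsto_poly_absv fst snd l)
    \<comment> \<open>The filter only sees pairs with \<open>x \<noteq> y\<close>, where the
      denominator can be cleared.\<close>
    moreover have "\<forall>\<^sub>F z in ?F.
        fst z * (\<lambda>(x, y). (poly P x - poly P y) / (x - y)) z + poly P (snd z) =
        (\<lambda>(x, y). (poly (pCons c P) x - poly (pCons c P) y) / (x - y)) z"
      unfolding eventually_at_filter
      by (intro always_eventually) (auto simp: field_simps)
    ultimately show ?case
      using tendsto_cong by fast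
  qed
qed

context
  assumes prime: "prime p"
begin

lemma of_nat_prime_power_tendsto_0: "(\<lambda>N. of_nat (p ^ N) :: 'a) \<longlonglongrightarrow> 0"
proof -
  \<comment> \<open>The multiplicity of \<open>p\<close> in \<open>p ^ N\<close> is
    \<open>N\<close>.\<close>
  have "dist (of_nat (p ^ N) :: 'a) 0 = inverse (real p) ^ N" for N
    using prime absv_of_int [of "int p ^ N"]
    by (simp add: absv_def prime_gt_0_nat divide_inverse power_inverse)
  moreover have "(\<lambda>N. inverse (real p) ^ N) \<longlonglongrightarrow> 0"
    using prime_gt_1_nat [OF prime] by (intro LIMSEQ_power_zero) (simp add: field_simps)
  ultimately show ?thesis
    by (subst tendsto_dist_iff) simp
qed

lemma poly_mean_tendsto:
  "\<exists>I :: 'a. (\<lambda>N. 1 / of_nat (p ^ N) * (\<Sum>y<p ^ N. poly P (of_nat y))) \<longlonglongrightarrow> I"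
proof -
  obtain Q :: "nat \<Rightarrow> 'a poly"
    where Q: "\<And>k n. (\<Sum>y<n. of_nat y ^ k) = of_nat n * poly (Q k) (of_nat n)"
    using power_sum_eq_poly by metis
  \<comment> \<open>By linearity the mean of \<open>P\<close> over \<open>p ^ N\<close> terms is
    \<open>R\<close> evaluated at \<open>p ^ N\<close>, so the limit is \<open>R(0)\<close> by
    continuity.\<close>
  define R where "R = (\<Sum>i\<le>degree P. smult (coeff P i) (Q i))"
  have "1 / of_nat (p ^ N) * (\<Sum>y<p ^ N. poly P (of_nat y)) = poly R (of_nat (p ^ N))" for N
  proof -
    have "(\<Sum>y<p ^ N. poly P (of_nat y)) =
        (\<Sum>i\<le>degree P. coeff P i * (\<Sum>y<p ^ N. of_nat y ^ i))"
      by (simp add: poly_altdef sum_distrib_left) (rule sum.swap)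
    also have "\<dots> = of_nat (p ^ N) * poly R (of_nat (p ^ N))"
      unfolding Q R_def by (simp add: poly_sum sum_distrib_left mult.left_commute)
    finally show ?thesis
      using prime_gt_0_nat [OF prime] by simp
  qed
  then show ?thesis
    using tendsto_poly_absv [OF of_nat_prime_power_tendsto_0, of R] by auto
qed

lemma volkenborn_integral_unique:
  fixes f :: "'a \<Rightarrow> 'a"
  assumes "has_volkenborn_integral p f I"
  shows "volkenborn_integral p f = I"
  unfolding volkenborn_integral_def
  using assms by (rule the_equality)
    (use assms in \<open>auto simp: has_volkenborn_integral_def intro: LIMSEQ_unique\<close>)

text \<open>Existence and uniqueness of the limit together ensure that the definite description
  denotes an actual integral.\<close>

lemma has_volkenborn_integral_poly:
  "has_volkenborn_integral p (poly P) (volkenborn_integral p (poly P) :: 'a)"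
  using poly_mean_tendsto [of P] uniformly_differentiable_poly [of P] volkenborn_integral_unique
  unfolding has_volkenborn_integral_def by metis

text \<open>The binomial theorem holds for the finite means and passes to the limit termwise. The
  summand \<open>+ 0\<close> keeps the integrals in the form occurring in
  \<open>volkenborn_exp p a 0\<close>.\<close>

lemma volkenborn_integral_binomial:
  fixes a b :: 'a
  shows "volkenborn_integral p (\<lambda>y. (a * y + b) ^ n) =
    (\<Sum>k\<le>n. of_nat (n choose k) * b ^ (n - k) * volkenborn_integral p (\<lambda>y. (a * y + 0) ^ k))"
proof (rule volkenborn_integral_unique)
  let ?I = "\<lambda>k. volkenborn_integral p (\<lambda>y. (a * y + 0) ^ k)"
  \<comment> \<open>Exhibits the integrands as polynomial functions, to which the existence result
    applies.\<close>
  have poly: "poly ([:c, a:] ^ k) = (\<lambda>y. (a * y + c) ^ k)" for c k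
    by (auto simp: poly_power add.commute mult.commute)
  have "(\<lambda>N. 1 / of_nat (p ^ N) * (\<Sum>y<p ^ N. (a * of_nat y + 0) ^ k)) \<longlonglongrightarrow> ?I k" for k
    using has_volkenborn_integral_poly [of "[:0, a:] ^ k"]
    unfolding poly has_volkenborn_integral_def by blast
  then have "(\<lambda>N. \<Sum>k\<le>n. of_nat (n choose k) * b ^ (n - k) *
      (1 / of_nat (p ^ N) * (\<Sum>y<p ^ N. (a * of_nat y + 0) ^ k))) \<longlonglongrightarrow>
      (\<Sum>k\<le>n. of_nat (n choose k) * b ^ (n - k) * ?I k)"
    by (intro tendsto_sum_absv tendsto_mult_absv tendsto_const)
  also have "(\<lambda>N. \<Sum>k\<le>n. of_nat (n choose k) * b ^ (n - k) *
      (1 / of_nat (p ^ N) * (\<Sum>y<p ^ N. (a * of_nat y + 0) ^ k))) =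
      (\<lambda>N. 1 / of_nat (p ^ N) * (\<Sum>y<p ^ N. (a * of_nat y + b) ^ n))"
  proof
    fix N
    have "(\<Sum>y<p ^ N. (a * of_nat y + b) ^ n) =
        (\<Sum>k\<le>n. of_nat (n choose k) * b ^ (n - k) * (\<Sum>y<p ^ N. (a * of_nat y + 0) ^ k))"
      unfolding binomial_ring [of _ b n] by (subst sum.swap) (simp add: sum_distrib_left mult_ac)
    then show "(\<Sum>k\<le>n. of_nat (n choose k) * b ^ (n - k) *
        (1 / of_nat (p ^ N) * (\<Sum>y<p ^ N. (a * of_nat y + 0) ^ k))) =
        1 / of_nat (p ^ N) * (\<Sum>y<p ^ N. (a * of_nat y + b) ^ n)"
      by (simp add: sum_distrib_left mult.left_commute)
  qed
  finally show "has_volkenborn_integral p (\<lambda>y. (a * y + b) ^ n)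
      (\<Sum>k\<le>n. of_nat (n choose k) * b ^ (n - k) * ?I k)"
    using uniformly_differentiable_poly [of "[:b, a:] ^ n"]
    unfolding poly has_volkenborn_integral_def by blast
qed

text \<open>Dividing the binomial expansion by \<open>fact n\<close> turns it into a Cauchy product
  of coefficients.\<close>

lemma volkenborn_exp_translate:
  fixes a b :: 'a
  shows "volkenborn_exp p a b = volkenborn_exp p a 0 * fps_exp b"
proof (rule fps_ext)
  fix n
  have "of_nat (n choose k) * b ^ (n - k) * I / fact n =
      I / fact k * (b ^ (n - k) / fact (n - k))" if "k \<le> n" for k and I :: 'a
    using that by (simp add: binomial_fact)
  then show "volkenborn_exp p a b $ n = (volkenborn_exp p a 0 * fps_exp b) $ n"
    by (simp add: volkenborn_exp_def volkenborn_integral_binomial [of a b] fps_mult_nth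
        sum_divide_distrib atMost_atLeast0)
qed

text \<open>Makes the denominator of the main identity a unit among power series.\<close>

lemma volkenborn_exp_nth_0: "volkenborn_exp p a b $ 0 = (1 :: 'a)"
proof -
  have "poly 1 = (\<lambda>y :: 'a. 1)"
    by auto
  then have "volkenborn_integral p (\<lambda>y :: 'a. 1) = 1"
    using uniformly_differentiable_poly [of 1] prime_gt_0_nat [OF prime]
    by (intro volkenborn_integral_unique) (simp add: has_volkenborn_integral_def)
  then show ?thesis
    by (simp add: volkenborn_exp_def)
qed

end

end

theorem theorem1:
  fixes p w1 w2 :: nat
    and x :: "'a::{field_char_0, complete_space}"
  assumes "prime p" and "is_Cp p TYPE('a)"
    and "w1 > 0" and "w2 > 0"
  shows
    "(fps_const (1 / of_nat w1) * volkenborn_exp p (of_nat w1) (of_nat w1 * (of_nat w2 * x))) *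
       ((fps_const (of_nat w1) * volkenborn_exp p (of_nat w2) 0) /
          volkenborn_exp p (of_nat w1 * of_nat w2) 0) =
     (fps_const (1 / of_nat w2) * volkenborn_exp p (of_nat w2) (of_nat w2 * (of_nat w1 * x))) *
       ((fps_const (of_nat w2) * volkenborn_exp p (of_nat w1) 0) /
          volkenborn_exp p (of_nat w1 * of_nat w2) 0)"
proof -
  let ?E = "\<lambda>a :: 'a. volkenborn_exp p a 0"
  let ?D = "?E (of_nat w1 * of_nat w2)"
  have divide: "f / ?D = f * inverse ?D" for f
    using volkenborn_exp_nth_0 [OF assms(2,1)] by (simp add: fps_divide_unit)
  have const: "fps_const (1 / of_nat w :: 'a) * e * (fps_const (of_nat w) * f * g) = e * f * g"
    if "w > 0" for w and e f g :: "'a fps"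
  proof -
    have "fps_const (1 / of_nat w :: 'a) * fps_const (of_nat w) = 1"
      using that by simp
    then show ?thesis
      by (metis (no_types, opaque_lifting) mult.assoc mult.commute mult_1)
  qed
  show ?thesis
    \<comment> \<open>The pattern \<open>_ * _\<close> restricts the translation rule to the two
      shifted exponentials; with shift \<open>0\<close> it would apply to its own result. Both
      shifts equal \<open>w1 * w2 * x\<close>, so the sides agree up to the order of
      factors.\<close>
    unfolding divide const [OF \<open>w1 > 0\<close>] const [OF \<open>w2 > 0\<close>]
      volkenborn_exp_translate [OF assms(2,1), of _ "_ * _"]
    by (simp add: mult_ac)
qed

end
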